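(* Let $\gamma\in\mathbb{R}$, $K>0$, and consider the stochastic dynamic on $\{+1,-1\}^{\mathbb{Z}}$ $$\phi(x,t+1)=\mathrm{sgn}\{K_{\lambda(t)}(\phi(x-1,t)+\phi(x+1,t))+(1-\gamma)\phi(x,t)+\xi(x,t)\},\qquad x\in\mathbb{Z},\ t=0,1,2,\dots,$$ with system parameter $K_{\lambda(t)}$ and with initial distribution $\phi(\cdot,0)\sim\mathbb{P}_0$, where $\mathbb{P}_0$ is the infinite-volume Gibbs measure of the zero-field nearest-neighbour Ising model on $\mathbb{Z}$ with coupling $K$. Let $f,g:\{+1,-1\}\to\mathbb{R}$ and let $x_1\neq x_2$ be sites in $\mathbb{Z}$. Then the two point observables satisfy $$\mathcal{S}^{fg}_{\lambda(t)}(x_1,x_2)\to\frac A4-\frac{C^4_{12}C^2_{12}}{4}\log\left(\frac{C^4_{12}C^2_{12}}{4}\right),$$ $$\mathcal{S}^{fg}(\lambda(t)x_1,\lambda(t)x_2)\to\frac A4-\frac{C^4_{12}C^2_{12}}{4}\log\left(\frac{C^4_{12}C^2_{12}}{4}\right),$$ as $t\to\infty$, $\lambda(t)\to\infty$ and $K_{\lambda(t)}\to K^*=0$.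
   Context: The $\{\xi(x,t)\}_{x\in\mathbb{Z},t\ge0}$ are independent standard Gaussian random variables, independent of $\phi(\cdot,0)$. $\lambda(t)>0$ is a deterministic scaling factor such that $\lambda(t)x_1,\lambda(t)x_2\in\mathbb{Z}$, and $K_{\lambda(t)}$ is a deterministic real coupling parameter depending on $t$ through $\lambda(t)$. $\mathbb{P}_0$ satisfies the DLR equations: for every finite $\Lambda\subset\mathbb{Z}$, $\mathbb{P}_0(\phi(x,0)=\sigma_x,x\in\Lambda\mid\phi(y,0)=\sigma_y,y\in\Lambda^c)=Z_{\partial_\Lambda}^{-1}\exp\{K\sum\sigma_x\sigma_y\}$, the sum being over nearest-neighbour pairs $\{x,y\}$ with at least one element in $\Lambda$, and $Z_{\partial_\Lambda}$ the normalizing constant. Observables: $\mathcal{S}^{fg}_{\lambda(t)}(x_1,x_2)=\mathbb{E}[F\log F]-\mathbb{E}[F]\log\mathbb{E}[F]$ with $F=f^2(\phi(x_1,t+1))g^2(\phi(x_2,t+1))$ and $\mathbb{E}$ the expectation for the dynamic. For sites $y_1,y_2\in\mathbb{Z}$, $\mathcal{S}^{fg}(y_1,y_2)=\mathbb{E}_{\mathbb{P}_0}[G\log G]-\mathbb{E}_{\mathbb{P}_0}[G]\log\mathbb{E}_{\mathbb{P}_0}[G]$ with $G=f^2(\phi(y_1,0))g^2(\phi(y_2,0))$. Convention $0\log0=0$. Constants: $A=a+b+c+d$ with $a=f^2(1)g^2(1)\log(f^2(1)g^2(1))$, $b=f^2(-1)g^2(1)\log(f^2(-1)g^2(1))$,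 $c=f^2(1)g^2(-1)\log(f^2(1)g^2(-1))$, $d=f^2(-1)g^2(-1)\log(f^2(-1)g^2(-1))$; $C^2_{12}=g^2(1)+g^2(-1)$, $C^4_{12}=f^2(1)+f^2(-1)$. *)

theory Defs
  imports "HOL-Probability.Probability"
begin

text \<open>
  Spins are the reals \<open>-1\<close> and \<open>1\<close>; the space of this measure is \<open>{+1,-1}\<^sup>\<int>\<close>, and only its
  product sigma algebra is used.
\<close>

definition spin_space :: "(int \<Rightarrow> real) measure" where
  "spin_space = (\<Pi>\<^sub>M x\<in>UNIV. count_space {-1, 1})"

text \<open>
  A nearest-neighbour pair \<open>{x, x + 1}\<close> is represented by its left end point \<open>x\<close>, so that every
  pair meeting \<open>\<Lambda>\<close> is counted exactly once.
\<close>

definition ising_weight :: "real \<Rightarrow> int set \<Rightarrow> (int \<Rightarrow> real) \<Rightarrow> real" where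
  "ising_weight K \<Lambda> \<sigma> = exp (K * (\<Sum>x | x \<in> \<Lambda> \<or> x + 1 \<in> \<Lambda>. \<sigma> x * \<sigma> (x + 1)))"

text \<open>
  The probability of \<open>\<sigma>\<close> on \<open>\<Lambda>\<close> given the boundary condition \<open>\<eta>\<close> off \<open>\<Lambda>\<close>; the denominator is the
  normalizing constant, which depends on \<open>\<eta>\<close>.
\<close>

definition ising_specification ::
    "real \<Rightarrow> int set \<Rightarrow> (int \<Rightarrow> real) \<Rightarrow> (int \<Rightarrow> real) \<Rightarrow> real" where
  "ising_specification K \<Lambda> \<eta> \<sigma> =
     ising_weight K \<Lambda> (override_on \<eta> \<sigma> \<Lambda>) /
     (\<Sum>\<tau>\<in>\<Lambda> \<rightarrow>\<^sub>E {-1, 1}. ising_weight K \<Lambda> (override_on \<eta> \<tau> \<Lambda>))"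

text \<open>The sigma algebra generated by the spins outside \<open>\<Lambda>\<close>.\<close>

definition exterior_algebra :: "int set \<Rightarrow> (int \<Rightarrow> real) measure" where
  "exterior_algebra \<Lambda> =
     vimage_algebra (space spin_space) (\<lambda>\<eta>. restrict \<eta> (- \<Lambda>)) (\<Pi>\<^sub>M x\<in>- \<Lambda>. count_space {-1, 1})"

lemma subalgebra_exterior_algebra:
  assumes "sets P = sets spin_space"
  shows "subalgebra P (exterior_algebra \<Lambda>)"
proof -
  have "(\<lambda>\<eta>. restrict \<eta> (- \<Lambda>)) \<in> spin_space \<rightarrow>\<^sub>M (\<Pi>\<^sub>M x\<in>- \<Lambda>. count_space {-1, 1})"
    unfolding spin_space_def by (rule measurable_restrict_subset) simp
  then have "sets (exterior_algebra \<Lambda>) \<subseteq> sets spin_space"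
    unfolding exterior_algebra_def
    by (rule sets_image_in_sets[OF refl])
  moreover have "space (exterior_algebra \<Lambda>) = space P"
    using sets_eq_imp_space_eq[OF assms] by (simp add: exterior_algebra_def)
  ultimately show ?thesis
    using assms by (simp add: subalgebra_def)
qed

text \<open>
  The DLR equations: for every finite \<open>\<Lambda>\<close>, the conditional probability of \<open>\<sigma>\<close> on \<open>\<Lambda>\<close>, given the
  spins outside \<open>\<Lambda>\<close>, is almost surely the one prescribed by the specification.
\<close>

definition ising_gibbs_measure :: "real \<Rightarrow> (int \<Rightarrow> real) measure \<Rightarrow> bool" where
  "ising_gibbs_measure K P \<longleftrightarrow>
     prob_space P \<and> sets P = sets spin_space \<and>
     (\<forall>\<Lambda>. finite \<Lambda> \<longrightarrow> (\<forall>\<sigma>\<in>\<Lambda> \<rightarrow>\<^sub>E {-1, 1}.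
        AE \<eta> in P. real_cond_exp P (exterior_algebra \<Lambda>)
            (indicator {\<eta> \<in> space P. \<forall>x\<in>\<Lambda>. \<eta> x = \<sigma> x}) \<eta> =
          ising_specification K \<Lambda> \<eta> \<sigma>))"

text \<open>
  The convention \<open>0 log 0 = 0\<close> holds automatically, because the factor \<open>0\<close> annihilates whatever
  value \<open>ln\<close> takes at \<open>0\<close>.
\<close>

definition two_point_observable ::
    "(real \<Rightarrow> real) \<Rightarrow> (real \<Rightarrow> real) \<Rightarrow> 'a measure \<Rightarrow> ('a \<Rightarrow> real) \<Rightarrow> ('a \<Rightarrow> real) \<Rightarrow> real" where
  "two_point_observable f g M X Y =
     (let F = (\<lambda>\<omega>. (f (X \<omega>))\<^sup>2 * (g (Y \<omega>))\<^sup>2)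
      in (\<integral>\<omega>. F \<omega> * ln (F \<omega>) \<partial>M) - (\<integral>\<omega>. F \<omega> \<partial>M) * ln (\<integral>\<omega>. F \<omega> \<partial>M))"

definition const_A :: "(real \<Rightarrow> real) \<Rightarrow> (real \<Rightarrow> real) \<Rightarrow> real" where
  "const_A f g =
     (f 1)\<^sup>2 * (g 1)\<^sup>2 * ln ((f 1)\<^sup>2 * (g 1)\<^sup>2) +
     (f (-1))\<^sup>2 * (g 1)\<^sup>2 * ln ((f (-1))\<^sup>2 * (g 1)\<^sup>2) +
     (f 1)\<^sup>2 * (g (-1))\<^sup>2 * ln ((f 1)\<^sup>2 * (g (-1))\<^sup>2) +
     (f (-1))\<^sup>2 * (g (-1))\<^sup>2 * ln ((f (-1))\<^sup>2 * (g (-1))\<^sup>2)"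

definition const_C2 :: "(real \<Rightarrow> real) \<Rightarrow> real" where
  "const_C2 g = (g 1)\<^sup>2 + (g (-1))\<^sup>2"

definition const_C4 :: "(real \<Rightarrow> real) \<Rightarrow> real" where
  "const_C4 f = (f 1)\<^sup>2 + (f (-1))\<^sup>2"

end

theory Submission
  imports Defs
begin

text \<open>
  Both limits reduce to the statement that two spins become independent and unbiased, that is, that
  their means and their correlation tend to \<open>0\<close>.

  For the dynamic, the noise at distinct sites is fresh and independent, so as the coupling vanishes
  each step multiplies the mean by \<open>c = E sgn (1 - \<gamma> + \<xi>)\<close> and the pair correlation by \<open>c\<^sup>2\<close>, up to an
  error tending to \<open>0\<close>; since \<open>\<bar>c\<bar> < 1\<close>, both tend to \<open>0\<close>.

  For the Gibbs measure, the DLR equation for a single site says that the conditional mean of a spin is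
  \<open>tanh (2 K) / 2\<close> times the sum of its two neighbours. Hence means and correlations are
  bounded solutions of a contracting averaging equation: the means vanish and the correlations decay
  like \<open>\<bar>tanh (2 K)\<bar>\<close> to the power of the distance.
\<close>

section \<open>Null sequences and the law of a pair of spins\<close>

text \<open>Once \<open>e\<close> stays below \<open>\<delta>\<close>, the sequence is dominated by
  iterates of v -> r v + \<delta>. The value \<delta> = (1 - r) \<epsilon> / 2 makes \<epsilon> / 2
  the fixed point of this map, so the excess over \<epsilon> / 2 shrinks like r^k.\<close>

lemma tendsto_zero_contraction:
  fixes u e :: "nat \<Rightarrow> real"
  assumes step: "\<And>n. \<bar>u (Suc n)\<bar> \<le> r * \<bar>u n\<bar> + e n" and "0 \<le> r" "r < 1" and "e \<longlonglongrightarrow> 0"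
  shows "u \<longlonglongrightarrow> 0"
proof (rule LIMSEQ_I)
  fix \<epsilon> :: real assume "\<epsilon> > 0"
  define \<delta> where "\<delta> = (1 - r) * (\<epsilon> / 2)"
  have "\<delta> > 0" using \<open>\<epsilon> > 0\<close> \<open>r < 1\<close> by (simp add: \<delta>_def)
  with \<open>e \<longlonglongrightarrow> 0\<close> obtain N where N: "\<bar>e n\<bar> < \<delta>" if "n \<ge> N" for n
    by (fastforce dest: LIMSEQ_D)
  have bound: "\<bar>u (N + k)\<bar> \<le> r ^ k * \<bar>u N\<bar> + \<epsilon> / 2" for k
  proof (induction k)
    case 0
    show ?case using \<open>\<epsilon> > 0\<close> by simp
  next
    case (Suc k)
    have "\<bar>u (N + Suc k)\<bar> \<le> r * \<bar>u (N + k)\<bar> + e (N + k)"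
      using step[of "N + k"] by simp
    also have "\<dots> \<le> r * (r ^ k * \<bar>u N\<bar> + \<epsilon> / 2) + \<delta>"
      using Suc N[of "N + k"] \<open>0 \<le> r\<close> by (intro add_mono mult_left_mono) auto
    also have "\<dots> = r ^ Suc k * \<bar>u N\<bar> + \<epsilon> / 2"
      by (simp add: \<delta>_def field_simps)
    finally show ?case .
  qed
  have "(\<lambda>k. r ^ k * \<bar>u N\<bar>) \<longlonglongrightarrow> 0"
    using assms by (intro tendsto_mult_left_zero LIMSEQ_realpow_zero)
  then obtain k0 where k0: "r ^ k * \<bar>u N\<bar> < \<epsilon> / 2" if "k \<ge> k0" for k
    using \<open>\<epsilon> > 0\<close> by (force dest!: LIMSEQ_D[where r = "\<epsilon> / 2"] simp: abs_less_iff)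
  show "\<exists>no. \<forall>n\<ge>no. norm (u n - 0) < \<epsilon>"
  proof (intro exI allI impI)
    fix n assume "n \<ge> N + k0"
    then have "k0 \<le> n - N" "N + (n - N) = n" by simp_all
    then show "norm (u n - 0) < \<epsilon>"
      using bound[of "n - N"] k0[of "n - N"] by simp
  qed
qed

text \<open>Away from 0 this is continuity of \<open>ln\<close>. The case \<open>l = 0\<close> is
  needed only for sequences that vanish identically: a limiting mean 0 of the nonnegative F forces F
  = 0 at all spin values.\<close>

lemma tendsto_mult_ln_self:
  fixes u :: "nat \<Rightarrow> real"
  assumes "u \<longlonglongrightarrow> l" and "l = 0 \<Longrightarrow> \<forall>n. u n = 0"
  shows "(\<lambda>n. u n * ln (u n)) \<longlonglongrightarrow> l * ln l"
  using assms by (cases "l = 0") (auto intro!: tendsto_intros)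

lemma abs_spin:
  fixes s :: real
  assumes "s \<in> {-1, 1}"
  shows "\<bar>s\<bar> = 1"
  using assms by auto

text \<open>For spins, (1 + a X)(1 + b Y) / 4 is the indicator of X = a, Y = b. Hence the joint law
  is determined by the two means and the correlation, and \<open>h\<close> is expanded over the four
  values.\<close>

lemma (in prob_space) expectation_spin_pair:
  fixes X Y :: "'a \<Rightarrow> real" and h :: "real \<Rightarrow> real \<Rightarrow> real"
  assumes [measurable]: "X \<in> borel_measurable M" "Y \<in> borel_measurable M"
    and X: "\<And>\<omega>. \<omega> \<in> space M \<Longrightarrow> X \<omega> \<in> {-1, 1}" and Y: "\<And>\<omega>. \<omega> \<in> space M \<Longrightarrow> Y \<omega> \<in> {-1, 1}"
  shows "expectation (\<lambda>\<omega>. h (X \<omega>) (Y \<omega>)) =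
    (\<Sum>a\<in>{-1, 1}. \<Sum>b\<in>{-1, 1}. h a b * (1 + a * expectation X + b * expectation Y
       + a * b * expectation (\<lambda>\<omega>. X \<omega> * Y \<omega>)) / 4)"
proof -
  have X1: "AE \<omega> in M. norm (X \<omega>) \<le> 1" and Y1: "AE \<omega> in M. norm (Y \<omega>) \<le> 1"
    and XY1: "AE \<omega> in M. norm (X \<omega> * Y \<omega>) \<le> 1"
    using X Y by (fastforce simp: abs_mult intro!: AE_I2)+
  have [simp]: "integrable M X" "integrable M Y" "integrable M (\<lambda>\<omega>. X \<omega> * Y \<omega>)"
    by (rule integrable_const_bound[OF X1] integrable_const_bound[OF Y1]
        integrable_const_bound[OF XY1]; measurable)+
  have "expectation (\<lambda>\<omega>. h (X \<omega>) (Y \<omega>)) = expectation (\<lambda>\<omega>.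
     (\<Sum>a\<in>{-1, 1}. \<Sum>b\<in>{-1, 1}. h a b * (1 + a * X \<omega> + b * Y \<omega> + a * b * (X \<omega> * Y \<omega>)) / 4))"
  proof (rule Bochner_Integration.integral_cong[OF refl])
    fix \<omega> assume "\<omega> \<in> space M"
    from X[OF this] Y[OF this]
    show "h (X \<omega>) (Y \<omega>) = (\<Sum>a\<in>{-1, 1}. \<Sum>b\<in>{-1, 1}.
        h a b * (1 + a * X \<omega> + b * Y \<omega> + a * b * (X \<omega> * Y \<omega>)) / 4)"
      by auto
  qed
  also have "\<dots> = (\<Sum>a\<in>{-1, 1}. \<Sum>b\<in>{-1, 1}. h a b * (1 + a * expectation X + b * expectation Y
       + a * b * expectation (\<lambda>\<omega>. X \<omega> * Y \<omega>)) / 4)"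
    by (simp add: prob_space)
  finally show ?thesis .
qed

text \<open>By \<open>expectation_spin_pair\<close>, vanishing means and correlation give each of
  the four spin pairs limiting probability 1/4. Applied to F and to F ln F, this produces the
  constants.\<close>

lemma tendsto_two_point_observable:
  fixes M :: "'w measure" and X Y :: "nat \<Rightarrow> 'w \<Rightarrow> real"
  assumes "prob_space M"
    and [measurable]: "\<And>n. X n \<in> borel_measurable M" "\<And>n. Y n \<in> borel_measurable M"
    and X: "\<And>n \<omega>. \<omega> \<in> space M \<Longrightarrow> X n \<omega> \<in> {-1, 1}"
    and Y: "\<And>n \<omega>. \<omega> \<in> space M \<Longrightarrow> Y n \<omega> \<in> {-1, 1}"
    and "(\<lambda>n. \<integral>\<omega>. X n \<omega> \<partial>M) \<longlonglongrightarrow> 0" and "(\<lambda>n. \<integral>\<omega>. Y n \<omega> \<partial>M) \<longlonglongrightarrow> 0"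
    and "(\<lambda>n. \<integral>\<omega>. X n \<omega> * Y n \<omega> \<partial>M) \<longlonglongrightarrow> 0"
  shows "(\<lambda>n. two_point_observable f g M (X n) (Y n)) \<longlonglongrightarrow>
    const_A f g / 4 - const_C4 f * const_C2 g / 4 * ln (const_C4 f * const_C2 g / 4)"
proof -
  interpret prob_space M by fact
  have moment: "(\<lambda>n. expectation (\<lambda>\<omega>. h (X n \<omega>) (Y n \<omega>))) \<longlonglongrightarrow>
      (\<Sum>a\<in>{-1, 1}. \<Sum>b\<in>{-1, 1}. h a b / 4)" for h :: "real \<Rightarrow> real \<Rightarrow> real"
  proof -
    have "(\<lambda>n. \<Sum>a\<in>{-1, 1}. \<Sum>b\<in>{-1, 1}. h a b * (1 + a * expectation (X n) + b * expectation (Y n)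
       + a * b * expectation (\<lambda>\<omega>. X n \<omega> * Y n \<omega>)) / 4) \<longlonglongrightarrow>
      (\<Sum>a\<in>{-1, 1}. \<Sum>b\<in>{-1, 1}. h a b * (1 + a * 0 + b * 0 + a * b * 0) / 4)"
      using assms by (intro tendsto_intros) auto
    then show ?thesis
      by (subst expectation_spin_pair) (use X Y in auto)
  qed
  let ?F = "\<lambda>a b :: real. (f a)\<^sup>2 * (g b)\<^sup>2"
  have limF: "(\<lambda>n. expectation (\<lambda>\<omega>. ?F (X n \<omega>) (Y n \<omega>))) \<longlonglongrightarrow> const_C4 f * const_C2 g / 4"
    using moment[of ?F] by (simp add: const_C4_def const_C2_def algebra_simps add_divide_distrib)
  have limL: "(\<lambda>n. expectation (\<lambda>\<omega>. ?F (X n \<omega>) (Y n \<omega>) * ln (?F (X n \<omega>) (Y n \<omega>)))) \<longlonglongrightarrow> const_A f g / 4"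
    using moment[of "\<lambda>a b. ?F a b * ln (?F a b)"] by (simp add: const_A_def algebra_simps add_divide_distrib)
  \<comment> \<open>The limiting mean is a product of sums of squares; if it is 0, then
    \<open>f\<close> or \<open>g\<close> vanishes at both spins.\<close>
  have zero: "expectation (\<lambda>\<omega>. ?F (X n \<omega>) (Y n \<omega>)) = 0" if "const_C4 f * const_C2 g / 4 = 0" for n
  proof -
    have "?F a b = 0" if "a \<in> {-1, 1}" "b \<in> {-1, 1}" for a b
      using that \<open>const_C4 f * const_C2 g / 4 = 0\<close>
      by (auto simp: const_C4_def const_C2_def add_nonneg_eq_0_iff)
    then have "expectation (\<lambda>\<omega>. ?F (X n \<omega>) (Y n \<omega>)) = expectation (\<lambda>_. 0)"
      using X Y by (intro Bochner_Integration.integral_cong) blast+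
    then show ?thesis by simp
  qed
  show ?thesis
    unfolding two_point_observable_def Let_def
    by (intro tendsto_diff limL tendsto_mult_ln_self limF) (use zero in auto)
qed

section \<open>Means and correlations of one-dimensional Ising Gibbs measures\<close>

lemma space_spin_space: "space spin_space = UNIV \<rightarrow>\<^sub>E {-1, 1}"
  by (simp add: spin_space_def space_PiM)

lemma spin_coordinate: "(\<lambda>\<eta>. \<eta> x) \<in> borel_measurable spin_space"
proof -
  have "(\<lambda>\<eta>. \<eta> x) \<in> spin_space \<rightarrow>\<^sub>M count_space {-1, 1}"
    unfolding spin_space_def by (rule measurable_component_singleton) simp
  then show ?thesis
    by (rule measurable_compose) simp
qed

lemma exterior_coordinate:
  assumes "y \<notin> \<Lambda>"
  shows "(\<lambda>\<eta>. \<eta> y) \<in> borel_measurable (exterior_algebra \<Lambda>)"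
proof -
  have *: "(\<lambda>\<zeta>. \<zeta> y) \<in> (\<Pi>\<^sub>M x\<in>- \<Lambda>. count_space {-1, 1 :: real}) \<rightarrow>\<^sub>M borel"
    by (rule measurable_compose[OF measurable_component_singleton, of _ _ _ _ borel])
       (use assms in auto)
  have r: "(\<lambda>\<eta>. restrict \<eta> (- \<Lambda>)) \<in> exterior_algebra \<Lambda> \<rightarrow>\<^sub>M (\<Pi>\<^sub>M x\<in>- \<Lambda>. count_space {-1, 1 :: real})"
    unfolding exterior_algebra_def
    by (rule measurable_vimage_algebra1) (auto simp: space_spin_space space_PiM)
  from measurable_compose[OF r *] show ?thesis using assms by simp
qed

text \<open>Two pairs meet the site, so the weights of the spin are exp (K s) and exp (- K s), with
  s the sum of the neighbours, and the conditional mean is tanh (K s). As s is -2, 0 or 2 and tanh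
  is odd, tanh (K s) is linear in s on these values.\<close>

lemma ising_specification_singleton:
  assumes \<eta>: "\<And>y. \<eta> y \<in> {-1, 1}"
  shows "2 * ising_specification K {x} \<eta> (\<lambda>_\<in>{x}. 1) - 1 =
    tanh (2 * K) / 2 * (\<eta> (x - 1) + \<eta> (x + 1))"
proof -
  let ?s = "\<eta> (x - 1) + \<eta> (x + 1)"
  have w: "ising_weight K {x} (override_on \<eta> \<tau> {x}) = exp (K * \<tau> x * ?s)" for \<tau>
  proof -
    have "{y. y \<in> {x} \<or> y + 1 \<in> {x}} = {x, x - 1}" by auto
    then show ?thesis by (simp add: ising_weight_def algebra_simps)
  qed
  have "(\<Sum>\<tau>\<in>{x} \<rightarrow>\<^sub>E {-1, 1}. exp (K * \<tau> x * ?s)) = (\<Sum>a\<in>{-1, 1}. exp (K * a * ?s))"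
    by (rule sum.reindex_bij_witness[of _ "\<lambda>a. \<lambda>_\<in>{x}. a" "\<lambda>\<tau>. \<tau> x"])
       (auto simp: PiE_def extensional_def restrict_def fun_eq_iff Pi_def)
  then have "ising_specification K {x} \<eta> (\<lambda>_\<in>{x}. 1) = exp (K * ?s) / (exp (- (K * ?s)) + exp (K * ?s))"
    by (simp add: ising_specification_def w)
  moreover have "exp (- (K * ?s)) + exp (K * ?s) > 0"
    by (simp add: add_pos_pos)
  ultimately have "2 * ising_specification K {x} \<eta> (\<lambda>_\<in>{x}. 1) - 1 = tanh (K * ?s)"
    by (simp add: tanh_altdef field_simps)
  moreover have "tanh (K * ?s) = tanh (2 * K) / 2 * ?s"
    using \<eta>[of "x - 1"] \<eta>[of "x + 1"] tanh_minus[of "2 * K"] by (auto simp: mult.commute)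
  ultimately show ?thesis by simp
qed

text \<open>Since \<open>Z\<close> is measurable with respect to the spins off \<open>x\<close>, the
  spin at \<open>x\<close> may be replaced under the integral by its conditional mean, which the
  single-site DLR equation supplies.\<close>

lemma ising_gibbs_neighbours:
  assumes gibbs: "ising_gibbs_measure K P"
    and Z: "Z \<in> borel_measurable (exterior_algebra {x})" and Z1: "\<And>\<eta>. \<eta> \<in> space P \<Longrightarrow> \<bar>Z \<eta>\<bar> \<le> 1"
  shows "(\<integral>\<eta>. Z \<eta> * \<eta> x \<partial>P) =
    tanh (2 * K) / 2 * ((\<integral>\<eta>. Z \<eta> * \<eta> (x - 1) \<partial>P) + (\<integral>\<eta>. Z \<eta> * \<eta> (x + 1) \<partial>P))"
proof -
  interpret prob_space P using gibbs by (simp add: ising_gibbs_measure_def)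
  have sets: "sets P = sets spin_space" using gibbs by (simp add: ising_gibbs_measure_def)
  interpret finite_measure_subalgebra P "exterior_algebra {x}"
    by unfold_locales (rule subalgebra_exterior_algebra[OF sets])
  have space: "space P = UNIV \<rightarrow>\<^sub>E {-1, 1}"
    using sets_eq_imp_space_eq[OF sets] by (simp add: space_spin_space)
  have coord [measurable]: "(\<lambda>\<eta>. \<eta> y) \<in> borel_measurable P" for y
    by (subst measurable_cong_sets[OF sets refl]) (rule spin_coordinate)
  have [measurable]: "Z \<in> borel_measurable P"
    by (rule measurable_from_subalg[OF subalg Z])
  have intZ: "integrable P (\<lambda>\<eta>. Z \<eta> * h \<eta>)"
    if [measurable]: "h \<in> borel_measurable P" and "\<And>\<eta>. \<eta> \<in> space P \<Longrightarrow> \<bar>h \<eta>\<bar> \<le> 1" for h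
  proof (rule integrable_const_bound[of _ 1])
    show "AE \<eta> in P. norm (Z \<eta> * h \<eta>) \<le> 1"
      using Z1 that by (auto simp: abs_mult intro!: AE_I2 mult_le_one)
  qed measurable
  have spin: "\<eta> y \<in> {-1, 1}" if "\<eta> \<in> space P" for \<eta> y
    using that by (auto simp: space)
  let ?I = "indicator {\<eta> \<in> space P. \<eta> x = 1} :: (int \<Rightarrow> real) \<Rightarrow> real"
  let ?E = "real_cond_exp P (exterior_algebra {x}) ?I"
  have ZI: "integrable P (\<lambda>\<eta>. Z \<eta> * ?I \<eta>)" and ZZ: "integrable P Z"
    using intZ[of ?I] intZ[of "\<lambda>_. 1"] by (auto split: split_indicator)
  note cond = real_cond_exp_intg[OF ZI Z]
  have "(\<lambda>_\<in>{x}. 1 :: real) \<in> {x} \<rightarrow>\<^sub>E {-1, 1}" by auto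
  with gibbs have "AE \<eta> in P. real_cond_exp P (exterior_algebra {x})
      (indicator {\<eta> \<in> space P. \<forall>y\<in>{x}. \<eta> y = (\<lambda>_\<in>{x}. 1) y}) \<eta> =
      ising_specification K {x} \<eta> (\<lambda>_\<in>{x}. 1)"
    unfolding ising_gibbs_measure_def by blast
  then have "AE \<eta> in P. ?E \<eta> = ising_specification K {x} \<eta> (\<lambda>_\<in>{x}. 1)"
    by simp
  then have E: "AE \<eta> in P. 2 * ?E \<eta> - 1 = tanh (2 * K) / 2 * (\<eta> (x - 1) + \<eta> (x + 1))"
  proof (rule AE_mp, intro AE_I2 impI)
    fix \<eta> assume \<eta>: "\<eta> \<in> space P" and E: "?E \<eta> = ising_specification K {x} \<eta> (\<lambda>_\<in>{x}. 1)"
    show "2 * ?E \<eta> - 1 = tanh (2 * K) / 2 * (\<eta> (x - 1) + \<eta> (x + 1))"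
      unfolding E by (rule ising_specification_singleton) (rule spin[OF \<eta>])
  qed
  have "(\<integral>\<eta>. Z \<eta> * \<eta> x \<partial>P) = (\<integral>\<eta>. 2 * (Z \<eta> * ?I \<eta>) - Z \<eta> \<partial>P)"
  proof (rule Bochner_Integration.integral_cong[OF refl])
    fix \<eta> assume "\<eta> \<in> space P"
    with spin[OF this, of x] show "Z \<eta> * \<eta> x = 2 * (Z \<eta> * ?I \<eta>) - Z \<eta>"
      by (auto split: split_indicator)
  qed
  also have "\<dots> = (\<integral>\<eta>. 2 * (Z \<eta> * ?E \<eta>) - Z \<eta> \<partial>P)"
    using ZI ZZ cond by simp
  also have "\<dots> = (\<integral>\<eta>. tanh (2 * K) / 2 * (Z \<eta> * \<eta> (x - 1) + Z \<eta> * \<eta> (x + 1)) \<partial>P)"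
  proof (rule integral_cong_AE)
    show "AE \<eta> in P. 2 * (Z \<eta> * ?E \<eta>) - Z \<eta> = tanh (2 * K) / 2 * (Z \<eta> * \<eta> (x - 1) + Z \<eta> * \<eta> (x + 1))"
      using E
    proof eventually_elim
      case (elim \<eta>)
      have "2 * (Z \<eta> * ?E \<eta>) - Z \<eta> = Z \<eta> * (2 * ?E \<eta> - 1)" by (simp add: algebra_simps)
      then show ?case unfolding elim by (simp add: algebra_simps)
    qed
  qed measurable
  also have "\<dots> = tanh (2 * K) / 2 * ((\<integral>\<eta>. Z \<eta> * \<eta> (x - 1) \<partial>P) + (\<integral>\<eta>. Z \<eta> * \<eta> (x + 1) \<partial>P))"
    using intZ[of "\<lambda>\<eta>. \<eta> (x - 1)"] intZ[of "\<lambda>\<eta>. \<eta> (x + 1)"] spin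
    by (simp add: abs_spin)
  finally show ?thesis .
qed

text \<open>Each use of the averaging equation gains a factor \<bar>a\<bar> and moves by one site,
  so it can be used \<open>n\<close> times before \<open>S\<close> is reached.\<close>

lemma neighbour_average_decay:
  fixes G :: "int \<Rightarrow> real"
  assumes avg: "\<And>y. y \<notin> S \<Longrightarrow> G y = a / 2 * (G (y - 1) + G (y + 1))"
    and bound: "\<And>y. \<bar>G y\<bar> \<le> 1" and far: "\<And>z. z \<in> S \<Longrightarrow> int n \<le> \<bar>y - z\<bar>"
  shows "\<bar>G y\<bar> \<le> \<bar>a\<bar> ^ n"
  using far
proof (induction n arbitrary: y)
  case 0
  show ?case using bound by simp
next
  case (Suc n)
  have "y \<notin> S" using Suc.prems[of y] by auto
  then have "\<bar>G y\<bar> = \<bar>a\<bar> / 2 * \<bar>G (y - 1) + G (y + 1)\<bar>"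
    by (simp add: avg[of y] abs_mult)
  also have "\<dots> \<le> \<bar>a\<bar> / 2 * (\<bar>a\<bar> ^ n + \<bar>a\<bar> ^ n)"
  proof (rule mult_left_mono)
    have "\<bar>G (y - 1)\<bar> \<le> \<bar>a\<bar> ^ n" "\<bar>G (y + 1)\<bar> \<le> \<bar>a\<bar> ^ n"
      by (rule Suc.IH; use Suc.prems in force)+
    then show "\<bar>G (y - 1) + G (y + 1)\<bar> \<le> \<bar>a\<bar> ^ n + \<bar>a\<bar> ^ n" by linarith
  qed simp
  finally show ?case by simp
qed

lemma abs_expectation_le_1:
  assumes "prob_space P" "\<And>\<omega>. \<omega> \<in> space P \<Longrightarrow> \<bar>h \<omega>\<bar> \<le> 1" "h \<in> borel_measurable P"
  shows "\<bar>\<integral>\<omega>. h \<omega> \<partial>P\<bar> \<le> (1 :: real)"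
proof -
  interpret prob_space P by fact
  have "norm (\<integral>\<omega>. h \<omega> \<partial>P) \<le> (\<integral>\<omega>. norm (h \<omega>) \<partial>P)" by simp
  also have "\<dots> \<le> (\<integral>\<omega>. 1 \<partial>P)"
    using assms by (intro integral_mono integrable_const_bound[of _ 1]) auto
  finally show ?thesis by (simp add: prob_space)
qed

text \<open>For fixed \<open>x\<close>, the spin at \<open>x\<close> is an admissible
  \<open>Z\<close> at every other site, so the correlation with \<open>x\<close> satisfies the
  averaging equation off \<open>S = {x}\<close>. The mean satisfies it everywhere, with
  \<open>Z = 1\<close>.\<close>

lemma ising_gibbs_correlation:
  assumes gibbs: "ising_gibbs_measure K P"
  shows "int n \<le> \<bar>y - x\<bar> \<Longrightarrow> \<bar>\<integral>\<eta>. \<eta> x * \<eta> y \<partial>P\<bar> \<le> \<bar>tanh (2 * K)\<bar> ^ n"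
    and ising_gibbs_mean: "(\<integral>\<eta>. \<eta> x \<partial>P) = 0"
proof -
  have prob: "prob_space P" and sets: "sets P = sets spin_space"
    using gibbs by (auto simp: ising_gibbs_measure_def)
  interpret prob_space P by fact
  have spin: "\<bar>\<eta> y\<bar> = 1" if "\<eta> \<in> space P" for \<eta> y
    using that by (intro abs_spin) (auto simp: sets_eq_imp_space_eq[OF sets] space_spin_space)
  have coord [measurable]: "(\<lambda>\<eta>. \<eta> y) \<in> borel_measurable P" for y
    by (subst measurable_cong_sets[OF sets refl]) (rule spin_coordinate)
  show "\<bar>\<integral>\<eta>. \<eta> x * \<eta> y \<partial>P\<bar> \<le> \<bar>tanh (2 * K)\<bar> ^ n" if far: "int n \<le> \<bar>y - x\<bar>"
  proof (rule neighbour_average_decay[where S = "{x}" and G = "\<lambda>z. \<integral>\<eta>. \<eta> x * \<eta> z \<partial>P"])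
    fix z assume "z \<notin> {x}"
    then show "(\<integral>\<eta>. \<eta> x * \<eta> z \<partial>P) =
        tanh (2 * K) / 2 * ((\<integral>\<eta>. \<eta> x * \<eta> (z - 1) \<partial>P) + (\<integral>\<eta>. \<eta> x * \<eta> (z + 1) \<partial>P))"
      by (intro ising_gibbs_neighbours[OF gibbs] exterior_coordinate) (auto simp: spin)
  next
    show "\<bar>\<integral>\<eta>. \<eta> x * \<eta> z \<partial>P\<bar> \<le> 1" for z
      by (rule abs_expectation_le_1[OF prob]) (auto simp: abs_mult spin)
  qed (use far in auto)
  \<comment> \<open>With \<open>S = {}\<close> the distance condition is vacuous, so the bound holds
    for every exponent and the mean must be 0.\<close>
  have "\<bar>\<integral>\<eta>. \<eta> x \<partial>P\<bar> \<le> \<bar>tanh (2 * K)\<bar> ^ m" for m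
  proof (rule neighbour_average_decay[where S = "{}" and G = "\<lambda>z. \<integral>\<eta>. \<eta> z \<partial>P"])
    show "(\<integral>\<eta>. \<eta> z \<partial>P) = tanh (2 * K) / 2 * ((\<integral>\<eta>. \<eta> (z - 1) \<partial>P) + (\<integral>\<eta>. \<eta> (z + 1) \<partial>P))" for z
      using ising_gibbs_neighbours[OF gibbs, of "\<lambda>_. 1" z] by simp
    show "\<bar>\<integral>\<eta>. \<eta> z \<partial>P\<bar> \<le> 1" for z
      by (rule abs_expectation_le_1[OF prob]) (auto simp: spin)
  qed auto
  moreover have "(\<lambda>m. \<bar>tanh (2 * K)\<bar> ^ m) \<longlonglongrightarrow> 0"
    using tanh_real_bounds[of "2 * K"] by (intro LIMSEQ_realpow_zero) auto
  ultimately have "\<bar>\<integral>\<eta>. \<eta> x \<partial>P\<bar> \<le> 0"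
    by (intro LIMSEQ_le_const) auto
  then show "(\<integral>\<eta>. \<eta> x \<partial>P) = 0" by simp
qed

section \<open>The Gaussian average of the sign\<close>

text \<open>This is 2 F(u) - 1 for the standard normal distribution function F. It serves as the
  conditional mean of an updated spin whose deterministic input is \<open>u\<close>.\<close>

definition mean_sgn :: "real \<Rightarrow> real" where
  "mean_sgn u = (\<integral>z. sgn (u + z) \<partial>std_normal_distribution)"

lemma mean_sgn_minus: "mean_sgn (- u) = - mean_sgn u"
proof -
  have "mean_sgn (- u) = (\<integral>z. std_normal_density z * sgn (- u + z) \<partial>lborel)"
    unfolding mean_sgn_def by (subst integral_density) auto
  \<comment> \<open>The substitution z -> -z, in the affine form of the transformation rule,
    exploits the symmetry of the density.\<close>
  also have "\<dots> = (\<integral>z. std_normal_density (0 + (-1) * z) * sgn (- u + (0 + (-1) * z)) \<partial>lborel)"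
    by (subst lborel_integral_real_affine[of "-1" _ 0]) auto
  also have "\<dots> = (\<integral>z. - (std_normal_density z * sgn (u + z)) \<partial>lborel)"
  proof (rule Bochner_Integration.integral_cong[OF refl])
    fix z :: real
    have "sgn (- u - z) = - sgn (u + z)" using sgn_minus[of "u + z"] by simp
    then show "std_normal_density (0 + - 1 * z) * sgn (- u + (0 + - 1 * z)) =
        - (std_normal_density z * sgn (u + z))"
      by (simp add: std_normal_density_def)
  qed
  also have "\<dots> = - mean_sgn u"
    unfolding mean_sgn_def by (subst integral_density) auto
  finally show ?thesis .
qed

lemma abs_mean_sgn_le_1: "\<bar>mean_sgn u\<bar> \<le> 1"
  unfolding mean_sgn_def
  by (rule abs_expectation_le_1[OF prob_space_normal_density]) (auto simp: sgn_if)

text \<open>For fixed z, the function u -> sgn (u + z) jumps only at u = -z. Thus at a given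
  \<open>u\<close> only the null set {-u} is bad, and dominated convergence applies.\<close>

lemma isCont_mean_sgn: "isCont mean_sgn u"
  unfolding continuous_at_sequentially comp_def mean_sgn_def
proof (intro allI impI)
  interpret prob_space std_normal_distribution by (rule prob_space_normal_density) simp
  fix v :: "nat \<Rightarrow> real" assume v: "v \<longlonglongrightarrow> u"
  have "AE z in lborel. z \<noteq> - u"
    by (rule AE_lborel_singleton)
  then have "AE z in std_normal_distribution. z \<noteq> - u"
    by (subst AE_density) auto
  then have lim: "AE z in std_normal_distribution. (\<lambda>n. sgn (v n + z)) \<longlonglongrightarrow> sgn (u + z)"
    by eventually_elim (use v in \<open>auto intro!: tendsto_intros\<close>)
  show "(\<lambda>n. \<integral>z. sgn (v n + z) \<partial>std_normal_distribution) \<longlonglongrightarrow> (\<integral>z. sgn (u + z) \<partial>std_normal_distribution)"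
    by (rule integral_dominated_convergence[where w = "\<lambda>_. 1", OF _ _ _ lim]) (auto simp: sgn_if)
qed

text \<open>A mean of 1 would force sgn (u + z) = 1 for almost all z, because the density is
  positive everywhere; but this fails on the whole interval from -u - 1 to -u.\<close>

lemma mean_sgn_less_1: "mean_sgn u < 1"
proof (rule ccontr)
  interpret prob_space std_normal_distribution by (rule prob_space_normal_density) simp
  assume "\<not> mean_sgn u < 1"
  with abs_mean_sgn_le_1[of u] have "mean_sgn u = 1" by auto
  have int: "integrable std_normal_distribution (\<lambda>z. sgn (u + z))"
    by (rule integrable_const_bound[of _ 1]) (auto simp: sgn_if)
  then have "(\<integral>z. 1 - sgn (u + z) \<partial>std_normal_distribution) = 0"
    using \<open>mean_sgn u = 1\<close> prob_space by (simp add: mean_sgn_def)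
  then have "AE z in std_normal_distribution. 1 - sgn (u + z) = 0"
    using int by (subst (asm) integral_nonneg_eq_0_iff_AE) (auto simp: sgn_if)
  then have "AE z in lborel. 1 - sgn (u + z) = 0"
    by (subst (asm) AE_density) (auto simp: normal_density_pos)
  then have "AE z in lborel. \<not> (z \<in> {- u - 1 .. - u})"
    by (rule AE_mp) (auto intro!: AE_I2 simp: sgn_if split: if_splits)
  then have "emeasure lborel {- u - 1 .. - u} = 0"
    by (subst (asm) AE_iff_measurable[of "{- u - 1 .. - u}"]) (auto simp del: atLeastAtMost_iff)
  then show False by simp
qed

lemma abs_mean_sgn_less_1: "\<bar>mean_sgn u\<bar> < 1"
  using mean_sgn_less_1[of u] mean_sgn_less_1[of "- u"] by (simp add: mean_sgn_minus abs_if)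

lemma (in prob_space) abs_expectation_diff_le:
  fixes h h' :: "'a \<Rightarrow> real"
  assumes [measurable]: "h \<in> borel_measurable M" "h' \<in> borel_measurable M"
    and "\<And>\<omega>. \<omega> \<in> space M \<Longrightarrow> \<bar>h \<omega>\<bar> \<le> 1" "\<And>\<omega>. \<omega> \<in> space M \<Longrightarrow> \<bar>h' \<omega>\<bar> \<le> 1"
    and close: "\<And>\<omega>. \<omega> \<in> space M \<Longrightarrow> \<bar>h \<omega> - h' \<omega>\<bar> \<le> e"
  shows "\<bar>expectation h - expectation h'\<bar> \<le> e"
proof -
  have [simp]: "integrable M h" "integrable M h'"
    using assms(3,4) by (intro integrable_const_bound[of _ 1] AE_I2; simp)+
  have "norm (expectation h - expectation h') = norm (expectation (\<lambda>\<omega>. h \<omega> - h' \<omega>))"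
    by simp
  also have "\<dots> \<le> expectation (\<lambda>\<omega>. norm (h \<omega> - h' \<omega>))"
    by (rule integral_norm_bound)
  also have "\<dots> \<le> expectation (\<lambda>_. e)"
    using close by (intro integral_mono) simp_all
  finally show ?thesis by (simp add: prob_space)
qed

lemma borel_measurable_mean_sgn [measurable]: "mean_sgn \<in> borel_measurable borel"
  by (intro borel_measurable_continuous_onI continuous_at_imp_continuous_on ballI isCont_mean_sgn)

section \<open>Averaging out an independent Gaussian\<close>

text \<open>A measure on the product is determined by rectangles, where independence is the product
  rule. Stating independence for families of preimages lets it be inherited from larger independent
  sigma algebras.\<close>

lemma (in prob_space) distr_pair_eq_pair_measure:
  assumes [measurable]: "X \<in> M \<rightarrow>\<^sub>M S" "Y \<in> M \<rightarrow>\<^sub>M T"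
    and indep: "indep_set {X -` A \<inter> space M | A. A \<in> sets S} {Y -` B \<inter> space M | B. B \<in> sets T}"
  shows "distr M S X \<Otimes>\<^sub>M distr M T Y = distr M (S \<Otimes>\<^sub>M T) (\<lambda>\<omega>. (X \<omega>, Y \<omega>))"
proof (rule pair_measure_eqI)
  interpret X: prob_space "distr M S X" by (rule prob_space_distr) measurable
  interpret Y: prob_space "distr M T Y" by (rule prob_space_distr) measurable
  show "sigma_finite_measure (distr M S X)" "sigma_finite_measure (distr M T Y)"
    by unfold_locales
  fix A B assume "A \<in> sets (distr M S X)" "B \<in> sets (distr M T Y)"
  then have [measurable]: "A \<in> sets S" "B \<in> sets T" by simp_all
  have "prob ((X -` A \<inter> space M) \<inter> (Y -` B \<inter> space M)) =
      prob (X -` A \<inter> space M) * prob (Y -` B \<inter> space M)"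
    by (rule indep_setD[OF indep]) auto
  moreover have "(\<lambda>\<omega>. (X \<omega>, Y \<omega>)) -` (A \<times> B) \<inter> space M = (X -` A \<inter> space M) \<inter> (Y -` B \<inter> space M)"
    by auto
  ultimately show "emeasure (distr M S X) A * emeasure (distr M T Y) B =
      emeasure (distr M (S \<Otimes>\<^sub>M T) (\<lambda>\<omega>. (X \<omega>, Y \<omega>))) (A \<times> B)"
    by (simp add: emeasure_distr emeasure_eq_measure ennreal_mult')
qed simp

text \<open>The joint law of (Z, h) and the noise is a product measure, so by Fubini the noise can
  be integrated first, with \<open>Z\<close> and \<open>h\<close> held fixed.\<close>

lemma (in prob_space) expectation_mult_sgn_noise:
  assumes [measurable]: "Z \<in> borel_measurable M" "h \<in> borel_measurable M"
    and indep: "indep_set {(\<lambda>\<omega>. (Z \<omega>, h \<omega>)) -` A \<inter> space M | A. A \<in> sets (borel \<Otimes>\<^sub>M borel)}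
                  {X -` B \<inter> space M | B. B \<in> sets borel}"
    and normal: "distributed M lborel X std_normal_density"
    and Z: "\<And>\<omega>. \<omega> \<in> space M \<Longrightarrow> \<bar>Z \<omega>\<bar> \<le> 1"
  shows "expectation (\<lambda>\<omega>. Z \<omega> * sgn (h \<omega> + X \<omega>)) = expectation (\<lambda>\<omega>. Z \<omega> * mean_sgn (h \<omega>))"
proof -
  let ?B = "borel \<Otimes>\<^sub>M borel :: (real \<times> real) measure"
  let ?D = "distr M ?B (\<lambda>\<omega>. (Z \<omega>, h \<omega>))"
  let ?F = "\<lambda>p :: (real \<times> real) \<times> real. fst (fst p) * sgn (snd (fst p) + snd p)"
  have [measurable]: "X \<in> borel_measurable M"
    using distributed_measurable[OF normal] by simp
  have joint: "?D \<Otimes>\<^sub>M distr M borel X = distr M (?B \<Otimes>\<^sub>M borel) (\<lambda>\<omega>. ((Z \<omega>, h \<omega>), X \<omega>))"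
    by (rule distr_pair_eq_pair_measure[OF _ _ indep]) measurable
  have law: "distr M borel X = std_normal_distribution"
    using normal by (simp add: distributed_def cong: distr_cong)
  interpret D: prob_space ?D by (rule prob_space_distr) measurable
  interpret N: prob_space std_normal_distribution by (rule prob_space_normal_density) simp
  interpret DN: pair_sigma_finite ?D std_normal_distribution ..
  have "integrable M (\<lambda>\<omega>. Z \<omega> * sgn (h \<omega> + X \<omega>))"
    by (rule integrable_const_bound[of _ 1]) (use Z in \<open>auto simp: sgn_if\<close>)
  then have int: "integrable (?D \<Otimes>\<^sub>M std_normal_distribution) ?F"
    unfolding joint[unfolded law] by (subst integrable_distr_eq) auto
  have "expectation (\<lambda>\<omega>. Z \<omega> * sgn (h \<omega> + X \<omega>)) = integral\<^sup>L (?D \<Otimes>\<^sub>M std_normal_distribution) ?F"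
    unfolding joint[unfolded law] by (subst integral_distr) auto
  also have "\<dots> = (\<integral>p. (\<integral>x. ?F (p, x) \<partial>std_normal_distribution) \<partial>?D)"
    by (rule DN.integral_fst'[OF int, symmetric])
  also have "\<dots> = (\<integral>p. fst p * mean_sgn (snd p) \<partial>?D)"
    by (simp add: mean_sgn_def)
  also have "\<dots> = expectation (\<lambda>\<omega>. Z \<omega> * mean_sgn (h \<omega>))"
    by (subst integral_distr) auto
  finally show ?thesis .
qed

lemma Int_stable_vimage_sets: "Int_stable {X -` A \<inter> S | A. A \<in> sets N}"
proof (rule Int_stableI)
  fix a b assume "a \<in> {X -` A \<inter> S | A. A \<in> sets N}" "b \<in> {X -` A \<inter> S | A. A \<in> sets N}"
  then obtain A B where "a = X -` A \<inter> S" "A \<in> sets N" "b = X -` B \<inter> S" "B \<in> sets N"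
    by blast
  then have "a \<inter> b = X -` (A \<inter> B) \<inter> S" "A \<inter> B \<in> sets N" by auto
  then show "a \<inter> b \<in> {X -` A \<inter> S | A. A \<in> sets N}" by blast
qed

section \<open>Independent sources of randomness in the dynamic\<close>

locale sign_dynamics = prob_space M for M :: "'w measure" +
  fixes \<phi> :: "nat \<Rightarrow> 'w \<Rightarrow> int \<Rightarrow> real"
    and \<xi> :: "int \<times> nat \<Rightarrow> 'w \<Rightarrow> real"
    and \<gamma> :: real and \<kappa> :: "nat \<Rightarrow> real"
  assumes normal: "\<And>i. distributed M lborel (\<xi> i) std_normal_density"
    and indep_noise: "indep_vars (\<lambda>_. borel) \<xi> UNIV"
    and indep_initial: "indep_set
           (sets (vimage_algebra (space M) (\<phi> 0) spin_space))
           (sets (vimage_algebra (space M) (\<lambda>\<omega> i. \<xi> i \<omega>) (\<Pi>\<^sub>M i\<in>UNIV. borel)))"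
    and measurable_\<phi> [measurable]: "\<And>t. \<phi> t \<in> M \<rightarrow>\<^sub>M spin_space"
    and dynamics: "\<And>x t. AE \<omega> in M. \<phi> (Suc t) \<omega> x =
           sgn (\<kappa> t * (\<phi> t \<omega> (x - 1) + \<phi> t \<omega> (x + 1)) + (1 - \<gamma>) * \<phi> t \<omega> x + \<xi> (x, t) \<omega>)"
begin

text \<open>The option type puts the initial configuration (\<open>None\<close>) and the single
  noise variables (\<open>Some i\<close>) into one family, so that independence of disjoint groups
  of sources becomes a single statement.\<close>

definition source_events :: "(int \<times> nat) option \<Rightarrow> 'w set set" where
  "source_events k = (case k of
     None \<Rightarrow> {\<phi> 0 -` A \<inter> space M | A. A \<in> sets spin_space}
   | Some i \<Rightarrow> {\<xi> i -` A \<inter> space M | A. A \<in> sets borel})"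

definition source_algebra :: "(int \<times> nat) option set \<Rightarrow> 'w measure" where
  "source_algebra J = sigma (space M) (\<Union>k\<in>J. source_events k)"

lemma measurable_\<xi> [measurable]: "\<xi> i \<in> borel_measurable M"
  using distributed_measurable[OF normal[of i]] by simp

lemma measurable_spin [measurable]: "(\<lambda>\<omega>. \<phi> t \<omega> x) \<in> borel_measurable M"
  by (rule measurable_compose[OF measurable_\<phi> spin_coordinate])

lemma spin_cases: "\<omega> \<in> space M \<Longrightarrow> \<phi> t \<omega> x \<in> {-1, 1}"
  using measurable_space[OF measurable_\<phi>, of \<omega> t] by (auto simp: space_spin_space)

lemma source_events_subset: "source_events k \<subseteq> events"
  by (auto simp: source_events_def split: option.splits)

lemma space_source_algebra [simp]: "space (source_algebra J) = space M"
  by (simp add: source_algebra_def space_measure_of_conv)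

lemma sets_source_algebra: "sets (source_algebra J) = sigma_sets (space M) (\<Union>k\<in>J. source_events k)"
  unfolding source_algebra_def
  using source_events_subset sets.space_closed[of M] by (intro sets_measure_of) blast

lemma source_algebra_mono: "I \<subseteq> J \<Longrightarrow> sets (source_algebra I) \<subseteq> sets (source_algebra J)"
  unfolding sets_source_algebra by (intro sigma_sets_mono') blast

lemma subalgebra_source_algebra: "subalgebra M (source_algebra J)"
  unfolding subalgebra_def sets_source_algebra
  using source_events_subset by (auto intro!: sets.sigma_sets_subset)

lemma measurable_source_algebra_mono:
  "h \<in> source_algebra I \<rightarrow>\<^sub>M N \<Longrightarrow> I \<subseteq> J \<Longrightarrow> h \<in> source_algebra J \<rightarrow>\<^sub>M N"
  by (rule measurable_from_subalg) (auto simp: subalgebra_def source_algebra_mono)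

lemma measurable_source_initial:
  assumes "None \<in> J"
  shows "(\<lambda>\<omega>. \<phi> 0 \<omega> x) \<in> borel_measurable (source_algebra J)"
proof -
  have "\<phi> 0 \<in> source_algebra J \<rightarrow>\<^sub>M spin_space"
  proof (rule measurableI)
    fix A assume "A \<in> sets spin_space"
    then have "\<phi> 0 -` A \<inter> space M \<in> source_events None"
      by (auto simp: source_events_def)
    then show "\<phi> 0 -` A \<inter> space (source_algebra J) \<in> sets (source_algebra J)"
      using assms by (auto simp: sets_source_algebra)
  qed (use measurable_space[OF measurable_\<phi>] in auto)
  then show ?thesis by (rule measurable_compose) (rule spin_coordinate)
qed

lemma measurable_source_noise:
  assumes "Some i \<in> J"
  shows "\<xi> i \<in> borel_measurable (source_algebra J)"
proof (rule measurableI)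
  fix A :: "real set" assume "A \<in> sets borel"
  then have "\<xi> i -` A \<inter> space M \<in> source_events (Some i)"
    by (auto simp: source_events_def)
  then show "\<xi> i -` A \<inter> space (source_algebra J) \<in> sets (source_algebra J)"
    using assms by (auto simp: sets_source_algebra)
qed simp

text \<open>The noise events factor among themselves by \<open>indep_noise\<close>. Their
  intersection belongs to the sigma algebra of the whole noise field, so
  \<open>indep_initial\<close> splits off the event of the initial configuration.\<close>

lemma indep_source_events: "indep_sets source_events UNIV"
proof (rule indep_setsI)
  fix A J assume J: "finite J" and A: "\<forall>k\<in>J. A k \<in> source_events k" "J \<noteq> {}"
  let ?V = "vimage_algebra (space M) (\<lambda>\<omega> i. \<xi> i \<omega>) (\<Pi>\<^sub>M i\<in>UNIV. borel)"
  define I where "I = {i. Some i \<in> J}"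
  have I: "finite I"
    using finite_vimageI[OF J, of Some] by (simp add: I_def vimage_def)
  have noise: "prob (\<Inter>i\<in>I. A (Some i)) = (\<Prod>i\<in>I. prob (A (Some i)))" if "I \<noteq> {}"
  proof (rule indep_setsD)
    show "indep_sets (\<lambda>i. {\<xi> i -` B \<inter> space M | B. B \<in> sets borel}) UNIV"
      using indep_noise by (simp add: indep_vars_def2)
    show "\<forall>i\<in>I. A (Some i) \<in> {\<xi> i -` B \<inter> space M | B. B \<in> sets borel}"
    proof
      fix i assume "i \<in> I"
      then have "A (Some i) \<in> source_events (Some i)" using A by (simp add: I_def)
      then show "A (Some i) \<in> {\<xi> i -` B \<inter> space M | B. B \<in> sets borel}"
        by (simp add: source_events_def)
    qed
  qed (use I that in auto)
  have V: "A (Some i) \<in> sets ?V" if "i \<in> I" for i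
  proof -
    have "\<xi> i \<in> borel_measurable ?V"
      by (rule measurable_compose[OF measurable_vimage_algebra1 measurable_component_singleton])
         (auto simp: space_PiM)
    moreover have "A (Some i) \<in> source_events (Some i)"
      using A that by (simp add: I_def)
    then obtain B where "B \<in> sets borel" "A (Some i) = \<xi> i -` B \<inter> space M"
      unfolding source_events_def option.case by blast
    ultimately show ?thesis using measurable_sets[of "\<xi> i" ?V borel B] by simp
  qed
  \<comment> \<open>\<open>J = {None}\<close> is a separate case because the product rule for the
    noise requires a nonempty index set.\<close>
  consider "J = Some ` I" | "J = {None}" | "J = insert None (Some ` I)" "I \<noteq> {}"
  proof -
    have "k \<in> J \<longleftrightarrow> k = None \<and> None \<in> J \<or> k \<in> Some ` I" for k
      by (cases k) (auto simp: I_def)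
    then have "J = Some ` I \<or> J = insert None (Some ` I)"
      by (cases "None \<in> J") auto
    then show ?thesis using that by (cases "I = {}") auto
  qed
  then show "prob (\<Inter>k\<in>J. A k) = (\<Prod>k\<in>J. prob (A k))"
  proof cases
    case 1
    then show ?thesis
      using noise A by (simp add: prod.reindex image_image)
  next
    case 2
    then show ?thesis by simp
  next
    case 3
    have "A None \<in> sets (vimage_algebra (space M) (\<phi> 0) spin_space)"
      using A 3 by (auto simp: source_events_def intro: in_vimage_algebra)
    moreover have "(\<Inter>i\<in>I. A (Some i)) \<in> sets ?V"
      using I 3 V by (intro sets.finite_INT) auto
    ultimately have "prob (A None \<inter> (\<Inter>i\<in>I. A (Some i))) = prob (A None) * prob (\<Inter>i\<in>I. A (Some i))"
      by (rule indep_setD[OF indep_initial])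
    then show ?thesis
      using 3 I noise by (simp add: prod.reindex image_image)
  qed
qed (rule source_events_subset)

lemma Int_stable_source_events: "Int_stable (source_events k)"
  by (cases k) (simp_all add: source_events_def Int_stable_vimage_sets)

text \<open>Disjoint groups of independent intersection-stable families generate independent sigma
  algebras; the two groups are indexed by the booleans.\<close>

lemma indep_source_algebras:
  assumes "I \<inter> J = {}"
  shows "indep_set (sets (source_algebra I)) (sets (source_algebra J))"
proof -
  have "indep_sets (\<lambda>b. sigma_sets (space M) (\<Union>k\<in>case_bool I J b. source_events k)) UNIV"
  proof (rule indep_sets_collect_sigma)
    show "indep_sets source_events (\<Union>b\<in>UNIV. case_bool I J b)"
      by (rule indep_sets_mono_index[OF _ indep_source_events]) simp
    show "disjoint_family_on (case_bool I J) UNIV"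
      using assms by (auto simp: disjoint_family_on_def split: bool.splits)
  qed (rule Int_stable_source_events)
  moreover have "(\<lambda>b. sigma_sets (space M) (\<Union>k\<in>case_bool I J b. source_events k)) =
      case_bool (sets (source_algebra I)) (sets (source_algebra J))"
    by (auto simp: fun_eq_iff sets_source_algebra split: bool.split)
  ultimately show ?thesis
    unfolding indep_set_def by simp
qed

lemma expectation_mult_sgn_fresh:
  assumes Z: "Z \<in> borel_measurable (source_algebra J)" and h: "h \<in> borel_measurable (source_algebra J)"
    and fresh: "Some i \<notin> J" and Z1: "\<And>\<omega>. \<omega> \<in> space M \<Longrightarrow> \<bar>Z \<omega>\<bar> \<le> 1"
  shows "expectation (\<lambda>\<omega>. Z \<omega> * sgn (h \<omega> + \<xi> i \<omega>)) = expectation (\<lambda>\<omega>. Z \<omega> * mean_sgn (h \<omega>))"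
proof (rule expectation_mult_sgn_noise[OF _ _ _ normal Z1])
  have Zh: "(\<lambda>\<omega>. (Z \<omega>, h \<omega>)) \<in> source_algebra J \<rightarrow>\<^sub>M borel \<Otimes>\<^sub>M borel"
    using Z h by measurable
  have \<xi>: "\<xi> i \<in> borel_measurable (source_algebra {Some i})"
    by (rule measurable_source_noise) simp
  have "indep_set (sets (source_algebra J)) (sets (source_algebra {Some i}))"
    using fresh by (intro indep_source_algebras) auto
  then show "indep_set {(\<lambda>\<omega>. (Z \<omega>, h \<omega>)) -` A \<inter> space M | A. A \<in> sets (borel \<Otimes>\<^sub>M borel)}
      {\<xi> i -` B \<inter> space M | B. B \<in> sets borel}"
    unfolding indep_set_def
    by (rule indep_sets_mono_sets)
       (use measurable_sets[OF Zh] measurable_sets[OF \<xi>] in \<open>auto split: bool.split\<close>)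
qed (rule measurable_from_subalg[OF subalgebra_source_algebra Z]
      measurable_from_subalg[OF subalgebra_source_algebra h])+

section \<open>One step of the dynamic\<close>

definition drift :: "nat \<Rightarrow> (int \<Rightarrow> real) \<Rightarrow> int \<Rightarrow> real" where
  "drift t \<eta> x = \<kappa> t * (\<eta> (x - 1) + \<eta> (x + 1)) + (1 - \<gamma>) * \<eta> x"

text \<open>
  \<open>\<phi>\<close> obeys the recursion only almost surely; this version obeys it everywhere and is therefore
  measurable with respect to the past.
\<close>

primrec path :: "nat \<Rightarrow> 'w \<Rightarrow> int \<Rightarrow> real" where
  "path 0 \<omega> = \<phi> 0 \<omega>"
| "path (Suc t) \<omega> = (\<lambda>x. sgn (drift t (path t \<omega>) x + \<xi> (x, t) \<omega>))"

text \<open>The noise with time index \<open>s\<close> enters at the update from \<open>s\<close> to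
  \<open>s + 1\<close>. Hence the configuration at time \<open>t\<close> uses only indices below
  \<open>t\<close>, and the noise at index \<open>t\<close> is fresh.\<close>

definition past :: "nat \<Rightarrow> (int \<times> nat) option set" where
  "past t = insert None (Some ` {(x, s). s < t})"

lemma path_eq: "AE \<omega> in M. path t \<omega> = \<phi> t \<omega>"
proof (induction t)
  case (Suc t)
  \<comment> \<open>There are countably many sites, so the exceptional null sets can be
    united.\<close>
  have "AE \<omega> in M. \<forall>x. \<phi> (Suc t) \<omega> x = sgn (drift t (\<phi> t \<omega>) x + \<xi> (x, t) \<omega>)"
    unfolding AE_all_countable drift_def using dynamics by blast
  with Suc show ?case by eventually_elim auto
qed simp

lemma measurable_path: "(\<lambda>\<omega>. path t \<omega> x) \<in> borel_measurable (source_algebra (past t))"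
proof (induction t arbitrary: x)
  case 0
  show ?case by (simp add: measurable_source_initial past_def)
next
  case (Suc t)
  have [measurable]: "(\<lambda>\<omega>. path t \<omega> y) \<in> borel_measurable (source_algebra (past (Suc t)))" for y
    by (rule measurable_source_algebra_mono[OF Suc]) (auto simp: past_def)
  have [measurable]: "\<xi> (y, t) \<in> borel_measurable (source_algebra (past (Suc t)))" for y
    by (rule measurable_source_noise) (auto simp: past_def)
  show ?case unfolding path.simps drift_def by measurable
qed

lemma measurable_drift_path:
  "(\<lambda>\<omega>. drift t (path t \<omega>) x) \<in> borel_measurable (source_algebra (past t))"
proof -
  note measurable_path [measurable]
  show ?thesis unfolding drift_def by measurable
qed

lemma measurable_drift [measurable]: "(\<lambda>\<omega>. drift t (\<phi> t \<omega>) x) \<in> borel_measurable M"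
  unfolding drift_def by measurable

lemma measurable_path_M [measurable]: "(\<lambda>\<omega>. path t \<omega> x) \<in> borel_measurable M"
  by (rule measurable_from_subalg[OF subalgebra_source_algebra measurable_path])

lemma measurable_drift_path_M [measurable]: "(\<lambda>\<omega>. drift t (path t \<omega>) x) \<in> borel_measurable M"
  by (rule measurable_from_subalg[OF subalgebra_source_algebra measurable_drift_path])

text \<open>The drift of \<open>path\<close> depends on the past alone, so the noise at time
  \<open>t\<close> can be averaged out there; \<open>path_eq\<close> moves the expectation to
  \<open>path\<close> and back.\<close>

lemma expectation_spin_Suc:
  "expectation (\<lambda>\<omega>. \<phi> (Suc t) \<omega> x) = expectation (\<lambda>\<omega>. mean_sgn (drift t (\<phi> t \<omega>) x))"
proof -
  have "expectation (\<lambda>\<omega>. \<phi> (Suc t) \<omega> x) = expectation (\<lambda>\<omega>. path (Suc t) \<omega> x)"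
    using path_eq[of "Suc t"]
    by (intro integral_cong_AE measurable_spin measurable_path_M) (elim AE_mp, auto)
  also have "\<dots> = expectation (\<lambda>\<omega>. 1 * sgn (drift t (path t \<omega>) x + \<xi> (x, t) \<omega>))"
    by simp
  also have "\<dots> = expectation (\<lambda>\<omega>. 1 * mean_sgn (drift t (path t \<omega>) x))"
    by (rule expectation_mult_sgn_fresh[OF _ measurable_drift_path]) (auto simp: past_def)
  also have "\<dots> = expectation (\<lambda>\<omega>. mean_sgn (drift t (\<phi> t \<omega>) x))"
  proof (rule integral_cong_AE)
    show "AE \<omega> in M. 1 * mean_sgn (drift t (path t \<omega>) x) = mean_sgn (drift t (\<phi> t \<omega>) x)"
      using path_eq[of t] by eventually_elim simp
  qed measurable
  finally show ?thesis .
qed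

text \<open>The two noises are averaged out in turn. The one at \<open>y\<close> goes first, with
  the one at \<open>x\<close> counted among the known sources \<open>?J\<close>; it is still fresh
  because the sites differ.\<close>

lemma expectation_spin_pair_Suc:
  assumes "x \<noteq> y"
  shows "expectation (\<lambda>\<omega>. \<phi> (Suc t) \<omega> x * \<phi> (Suc t) \<omega> y) =
    expectation (\<lambda>\<omega>. mean_sgn (drift t (\<phi> t \<omega>) x) * mean_sgn (drift t (\<phi> t \<omega>) y))"
proof -
  let ?d = "\<lambda>x \<omega>. drift t (path t \<omega>) x"
  let ?J = "insert (Some (x, t)) (past t)"
  have "past t \<subseteq> ?J" by auto
  note [measurable] = measurable_drift_path
    measurable_source_algebra_mono[OF measurable_drift_path \<open>past t \<subseteq> ?J\<close>]
  have [measurable]: "\<xi> (x, t) \<in> borel_measurable (source_algebra ?J)"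
    by (rule measurable_source_noise) simp
  have "expectation (\<lambda>\<omega>. \<phi> (Suc t) \<omega> x * \<phi> (Suc t) \<omega> y) =
      expectation (\<lambda>\<omega>. path (Suc t) \<omega> x * path (Suc t) \<omega> y)"
    using path_eq[of "Suc t"]
    by (intro integral_cong_AE borel_measurable_times measurable_spin measurable_path_M)
       (elim AE_mp, auto)
  also have "\<dots> = expectation (\<lambda>\<omega>. sgn (?d x \<omega> + \<xi> (x, t) \<omega>) * sgn (?d y \<omega> + \<xi> (y, t) \<omega>))"
    by simp
  also have "\<dots> = expectation (\<lambda>\<omega>. sgn (?d x \<omega> + \<xi> (x, t) \<omega>) * mean_sgn (?d y \<omega>))"
  proof (rule expectation_mult_sgn_fresh[where J = ?J])
    show "(\<lambda>\<omega>. sgn (?d x \<omega> + \<xi> (x, t) \<omega>)) \<in> borel_measurable (source_algebra ?J)" by measurable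
    show "?d y \<in> borel_measurable (source_algebra ?J)" by measurable
    show "Some (y, t) \<notin> ?J" using assms by (auto simp: past_def)
  qed (simp add: abs_sgn_eq)
  also have "\<dots> = expectation (\<lambda>\<omega>. mean_sgn (?d y \<omega>) * sgn (?d x \<omega> + \<xi> (x, t) \<omega>))"
    by (simp add: mult.commute)
  also have "\<dots> = expectation (\<lambda>\<omega>. mean_sgn (?d y \<omega>) * mean_sgn (?d x \<omega>))"
  proof (rule expectation_mult_sgn_fresh[where J = "past t"])
    show "(\<lambda>\<omega>. mean_sgn (?d y \<omega>)) \<in> borel_measurable (source_algebra (past t))" by measurable
    show "?d x \<in> borel_measurable (source_algebra (past t))" by measurable
  qed (auto simp: past_def abs_mean_sgn_le_1)
  also have "\<dots> = expectation (\<lambda>\<omega>. mean_sgn (drift t (\<phi> t \<omega>) x) * mean_sgn (drift t (\<phi> t \<omega>) y))"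
  proof (rule integral_cong_AE)
    show "AE \<omega> in M. mean_sgn (?d y \<omega>) * mean_sgn (?d x \<omega>) =
        mean_sgn (drift t (\<phi> t \<omega>) x) * mean_sgn (drift t (\<phi> t \<omega>) y)"
      using path_eq[of t] by eventually_elim simp
  qed measurable
  finally show ?thesis .
qed

section \<open>Contraction as the coupling vanishes\<close>

text \<open>Summing over all eight configurations of a site and its neighbours gives a deterministic
  bound for each of them, uniform in the sample point and the site.\<close>

definition coupling_error :: "nat \<Rightarrow> real" where
  "coupling_error t = (\<Sum>a\<in>{-1, 1}. \<Sum>b\<in>{-1, 1}. \<Sum>s\<in>{-1, 1}.
     \<bar>mean_sgn (\<kappa> t * (a + b) + (1 - \<gamma>) * s) - mean_sgn (1 - \<gamma>) * s\<bar>)"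

lemma coupling_error_tendsto:
  assumes "\<kappa> \<longlonglongrightarrow> 0"
  shows "coupling_error \<longlonglongrightarrow> 0"
proof -
  have "(\<lambda>t. \<bar>mean_sgn (\<kappa> t * (a + b) + (1 - \<gamma>) * s) - mean_sgn (1 - \<gamma>) * s\<bar>) \<longlonglongrightarrow> 0"
    if "s \<in> {-1, 1}" for a b s :: real
  proof -
    have "(\<lambda>t. mean_sgn (\<kappa> t * (a + b) + (1 - \<gamma>) * s)) \<longlonglongrightarrow> mean_sgn (0 * (a + b) + (1 - \<gamma>) * s)"
      by (intro isCont_tendsto_compose[OF isCont_mean_sgn] tendsto_intros assms)
    \<comment> \<open>At zero coupling the neighbours drop out, and since \<open>mean_sgn\<close> is
      odd the spin \<open>s\<close> can be pulled out as a factor.\<close>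
    moreover have "mean_sgn (0 * (a + b) + (1 - \<gamma>) * s) = mean_sgn (1 - \<gamma>) * s"
      using that mean_sgn_minus[of "1 - \<gamma>"] by auto
    ultimately show ?thesis
      by (simp add: LIM_zero_iff tendsto_rabs_zero_iff)
  qed
  then have "(\<lambda>t. coupling_error t) \<longlonglongrightarrow> (\<Sum>a\<in>{-1, 1 :: real}. \<Sum>b\<in>{-1, 1 :: real}. \<Sum>s\<in>{-1, 1 :: real}. 0)"
    unfolding coupling_error_def by (intro tendsto_sum)
  then show ?thesis by simp
qed

lemma mean_sgn_drift_close:
  assumes "\<omega> \<in> space M"
  shows "\<bar>mean_sgn (drift t (\<phi> t \<omega>) x) - mean_sgn (1 - \<gamma>) * \<phi> t \<omega> x\<bar> \<le> coupling_error t"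
proof -
  let ?T = "\<lambda>a b s. \<bar>mean_sgn (\<kappa> t * (a + b) + (1 - \<gamma>) * s) - mean_sgn (1 - \<gamma>) * s\<bar>"
  let ?a = "\<phi> t \<omega> (x - 1)" and ?b = "\<phi> t \<omega> (x + 1)" and ?s = "\<phi> t \<omega> x"
  have "?T ?a ?b ?s \<le> (\<Sum>s\<in>{-1, 1}. ?T ?a ?b s)"
    using spin_cases[OF assms] by (intro member_le_sum) auto
  also have "\<dots> \<le> (\<Sum>b\<in>{-1, 1}. \<Sum>s\<in>{-1, 1}. ?T ?a b s)"
    using spin_cases[OF assms] by (intro member_le_sum sum_nonneg) auto
  also have "\<dots> \<le> coupling_error t"
    unfolding coupling_error_def
    using spin_cases[OF assms] by (intro member_le_sum sum_nonneg) auto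
  finally show ?thesis by (simp only: drift_def)
qed

lemma abs_spin_eq: "\<omega> \<in> space M \<Longrightarrow> \<bar>\<phi> t \<omega> x\<bar> = 1"
  by (rule abs_spin[OF spin_cases])

text \<open>Up to \<open>coupling_error t\<close>, the conditional mean of the new spin is
  \<open>mean_sgn (1 - \<gamma>)\<close> times the old one, a factor of modulus below 1.\<close>

lemma mean_spin_tendsto:
  assumes "\<kappa> \<longlonglongrightarrow> 0"
  shows "(\<lambda>t. expectation (\<lambda>\<omega>. \<phi> t \<omega> x)) \<longlonglongrightarrow> 0"
proof (rule tendsto_zero_contraction)
  fix t
  let ?c = "mean_sgn (1 - \<gamma>)"
  have "\<bar>expectation (\<lambda>\<omega>. mean_sgn (drift t (\<phi> t \<omega>) x)) - expectation (\<lambda>\<omega>. ?c * \<phi> t \<omega> x)\<bar>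
      \<le> coupling_error t"
    by (rule abs_expectation_diff_le)
       (auto simp: abs_mult abs_spin_eq abs_mean_sgn_le_1 mean_sgn_drift_close)
  then show "\<bar>expectation (\<lambda>\<omega>. \<phi> (Suc t) \<omega> x)\<bar> \<le> \<bar>?c\<bar> * \<bar>expectation (\<lambda>\<omega>. \<phi> t \<omega> x)\<bar> + coupling_error t"
    by (simp add: expectation_spin_Suc flip: abs_mult)
qed (auto simp: abs_mean_sgn_less_1 coupling_error_tendsto[OF assms])

lemma pair_correlation_tendsto:
  assumes "\<kappa> \<longlonglongrightarrow> 0" and "x \<noteq> y"
  shows "(\<lambda>t. expectation (\<lambda>\<omega>. \<phi> t \<omega> x * \<phi> t \<omega> y)) \<longlonglongrightarrow> 0"
proof (rule tendsto_zero_contraction)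
  fix t
  let ?c = "mean_sgn (1 - \<gamma>)"
  let ?q = "\<lambda>x \<omega>. mean_sgn (drift t (\<phi> t \<omega>) x)"
  have close: "\<bar>?q x \<omega> * ?q y \<omega> - ?c\<^sup>2 * (\<phi> t \<omega> x * \<phi> t \<omega> y)\<bar> \<le> 2 * coupling_error t"
    if "\<omega> \<in> space M" for \<omega>
  proof -
    \<comment> \<open>The difference of products is split so that one factor changes at a time; each
      of the two terms costs one \<open>coupling_error t\<close>.\<close>
    have "\<bar>?q x \<omega> * ?q y \<omega> - ?c\<^sup>2 * (\<phi> t \<omega> x * \<phi> t \<omega> y)\<bar> =
        \<bar>?q x \<omega> * (?q y \<omega> - ?c * \<phi> t \<omega> y) + (?c * \<phi> t \<omega> y) * (?q x \<omega> - ?c * \<phi> t \<omega> x)\<bar>"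
      by (simp add: algebra_simps power2_eq_square)
    also have "\<dots> \<le> \<bar>?q x \<omega>\<bar> * \<bar>?q y \<omega> - ?c * \<phi> t \<omega> y\<bar> + \<bar>?c * \<phi> t \<omega> y\<bar> * \<bar>?q x \<omega> - ?c * \<phi> t \<omega> x\<bar>"
      using abs_triangle_ineq by (simp flip: abs_mult)
    also have "\<dots> \<le> 1 * coupling_error t + 1 * coupling_error t"
      using that by (intro add_mono mult_mono mean_sgn_drift_close)
        (auto simp: abs_mult abs_spin_eq abs_mean_sgn_le_1)
    finally show ?thesis by simp
  qed
  have "\<bar>expectation (\<lambda>\<omega>. ?q x \<omega> * ?q y \<omega>) - expectation (\<lambda>\<omega>. ?c\<^sup>2 * (\<phi> t \<omega> x * \<phi> t \<omega> y))\<bar>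
      \<le> 2 * coupling_error t"
  proof (rule abs_expectation_diff_le[OF _ _ _ _ close])
    show "\<bar>?q x \<omega> * ?q y \<omega>\<bar> \<le> 1" for \<omega>
      by (simp add: abs_mult abs_mean_sgn_le_1 mult_le_one)
    show "\<bar>?c\<^sup>2 * (\<phi> t \<omega> x * \<phi> t \<omega> y)\<bar> \<le> 1" if "\<omega> \<in> space M" for \<omega>
      using that abs_mean_sgn_le_1[of "1 - \<gamma>"] by (simp add: abs_mult abs_spin_eq abs_square_le_1)
  qed measurable
  then show "\<bar>expectation (\<lambda>\<omega>. \<phi> (Suc t) \<omega> x * \<phi> (Suc t) \<omega> y)\<bar> \<le>
      ?c\<^sup>2 * \<bar>expectation (\<lambda>\<omega>. \<phi> t \<omega> x * \<phi> t \<omega> y)\<bar> + 2 * coupling_error t"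
    using abs_mult[of "?c\<^sup>2" "expectation (\<lambda>\<omega>. \<phi> t \<omega> x * \<phi> t \<omega> y)"]
    by (simp add: expectation_spin_pair_Suc[OF \<open>x \<noteq> y\<close>])
next
  show "(mean_sgn (1 - \<gamma>))\<^sup>2 < 1"
    using abs_mean_sgn_less_1 by (simp add: abs_square_less_1)
  show "(\<lambda>t. 2 * coupling_error t) \<longlonglongrightarrow> 0"
    using tendsto_mult_right_zero[OF coupling_error_tendsto[OF assms(1)]] .
qed simp

end

section \<open>The limits of the two observables\<close>

theorem theorem5p3:
  fixes M :: "'w measure"
    and P0 :: "(int \<Rightarrow> real) measure"
    and \<phi> :: "nat \<Rightarrow> 'w \<Rightarrow> int \<Rightarrow> real"
    and \<xi> :: "int \<times> nat \<Rightarrow> 'w \<Rightarrow> real"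
    and \<gamma> K :: real
    and lam :: "nat \<Rightarrow> real"
    and K_of :: "real \<Rightarrow> real"
    and f g :: "real \<Rightarrow> real"
    and x1 x2 :: int
  assumes "prob_space M"
    and "K > 0"
    and "ising_gibbs_measure K P0"
    and "\<And>x t. distributed M lborel (\<xi> (x, t)) std_normal_density"
    and "prob_space.indep_vars M (\<lambda>_. borel) \<xi> UNIV"
    and "prob_space.indep_set M
           (sets (vimage_algebra (space M) (\<phi> 0) spin_space))
           (sets (vimage_algebra (space M) (\<lambda>\<omega> i. \<xi> i \<omega>) (\<Pi>\<^sub>M i\<in>UNIV. borel)))"
    and "\<And>t. \<phi> t \<in> M \<rightarrow>\<^sub>M spin_space"
    and "distr M spin_space (\<phi> 0) = P0"
    and "\<And>x t. AE \<omega> in M. \<phi> (Suc t) \<omega> x =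
           sgn (K_of (lam t) * (\<phi> t \<omega> (x - 1) + \<phi> t \<omega> (x + 1)) + (1 - \<gamma>) * \<phi> t \<omega> x + \<xi> (x, t) \<omega>)"
    and "x1 \<noteq> x2"
    and "\<And>t. lam t > 0"
    and "\<And>t. lam t * real_of_int x1 \<in> \<int>"
    and "\<And>t. lam t * real_of_int x2 \<in> \<int>"
    and "filterlim lam at_top sequentially"
    and "(\<lambda>t. K_of (lam t)) \<longlonglongrightarrow> 0"
  shows "(\<lambda>t. two_point_observable f g M
              (\<lambda>\<omega>. \<phi> (t + 1) \<omega> x1) (\<lambda>\<omega>. \<phi> (t + 1) \<omega> x2))
            \<longlonglongrightarrow> const_A f g / 4 -
                const_C4 f * const_C2 g / 4 * ln (const_C4 f * const_C2 g / 4)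
       \<and> (\<lambda>t. two_point_observable f g P0
              (\<lambda>\<eta>. \<eta> \<lfloor>lam t * real_of_int x1\<rfloor>) (\<lambda>\<eta>. \<eta> \<lfloor>lam t * real_of_int x2\<rfloor>))
            \<longlonglongrightarrow> const_A f g / 4 -
                const_C4 f * const_C2 g / 4 * ln (const_C4 f * const_C2 g / 4)"
proof
  interpret M: prob_space M by fact
  interpret sign_dynamics M \<phi> \<xi> \<gamma> "\<lambda>t. K_of (lam t)"
  proof (unfold_locales)
    show "distributed M lborel (\<xi> i) std_normal_density" for i
      using assms(4)[of "fst i" "snd i"] by simp
  qed (use assms in auto)
  show "(\<lambda>t. two_point_observable f g M
              (\<lambda>\<omega>. \<phi> (t + 1) \<omega> x1) (\<lambda>\<omega>. \<phi> (t + 1) \<omega> x2))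
            \<longlonglongrightarrow> const_A f g / 4 -
                const_C4 f * const_C2 g / 4 * ln (const_C4 f * const_C2 g / 4)"
    \<comment> \<open>\<open>LIMSEQ_Suc\<close> accounts for the observable being taken at time t +
      1.\<close>
    using mean_spin_tendsto[OF assms(15), THEN LIMSEQ_Suc]
      pair_correlation_tendsto[OF assms(15) assms(10), THEN LIMSEQ_Suc]
    by (intro tendsto_two_point_observable) (simp_all add: assms(1) spin_cases[simplified])
next
  interpret P0: prob_space P0
    using \<open>ising_gibbs_measure K P0\<close> by (simp add: ising_gibbs_measure_def)
  have sets: "sets P0 = sets spin_space"
    using \<open>ising_gibbs_measure K P0\<close> by (simp add: ising_gibbs_measure_def)
  let ?y1 = "\<lambda>t. \<lfloor>lam t * real_of_int x1\<rfloor>" and ?y2 = "\<lambda>t. \<lfloor>lam t * real_of_int x2\<rfloor>"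
  let ?n = "\<lambda>t. nat \<lfloor>lam t\<rfloor>"
  \<comment> \<open>The rescaled sites are integers, so their floors are exact. Distinct integers
    \<open>x1\<close>, \<open>x2\<close> differ by at least 1, so the rescaled distance is at least
    \<open>lam t\<close>, and rounding down makes this an exponent for the decay bound.\<close>
  have dist: "int (?n t) \<le> \<bar>?y2 t - ?y1 t\<bar>" for t
  proof -
    have "lam t * 1 \<le> lam t * \<bar>real_of_int x2 - real_of_int x1\<bar>"
      using assms(10) assms(11)[of t] by (intro mult_left_mono) linarith+
    also have "\<dots> = \<bar>lam t * real_of_int x2 - lam t * real_of_int x1\<bar>"
      using assms(11)[of t] by (simp add: abs_mult flip: right_diff_distrib)
    also have "\<dots> = real_of_int \<bar>?y2 t - ?y1 t\<bar>"
    proof -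
      have "real_of_int (?y1 t) = lam t * real_of_int x1" "real_of_int (?y2 t) = lam t * real_of_int x2"
        using assms(12,13)[of t] by (auto elim!: Ints_cases)
      then show ?thesis by (simp only: of_int_abs of_int_diff)
    qed
    finally show ?thesis
      using assms(11)[of t] by linarith
  qed
  have decay: "(\<lambda>t. \<bar>tanh (2 * K)\<bar> ^ ?n t) \<longlonglongrightarrow> 0"
  proof (rule filterlim_compose[OF LIMSEQ_realpow_zero])
    show "\<bar>tanh (2 * K)\<bar> < 1" using tanh_real_bounds[of "2 * K"] by auto
    show "filterlim ?n sequentially sequentially"
      by (intro filterlim_compose[OF filterlim_nat_sequentially]
          filterlim_compose[OF filterlim_floor_sequentially] assms(14))
  qed simp
  have corr: "(\<lambda>t. \<integral>\<eta>. \<eta> (?y1 t) * \<eta> (?y2 t) \<partial>P0) \<longlonglongrightarrow> 0"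
    by (rule Lim_null_comparison[OF _ decay])
       (use ising_gibbs_correlation(1)[OF \<open>ising_gibbs_measure K P0\<close> dist] in auto)
  show "(\<lambda>t. two_point_observable f g P0
              (\<lambda>\<eta>. \<eta> \<lfloor>lam t * real_of_int x1\<rfloor>) (\<lambda>\<eta>. \<eta> \<lfloor>lam t * real_of_int x2\<rfloor>))
            \<longlonglongrightarrow> const_A f g / 4 -
                const_C4 f * const_C2 g / 4 * ln (const_C4 f * const_C2 g / 4)"
  proof (rule tendsto_two_point_observable[OF P0.prob_space_axioms])
    show "(\<lambda>\<eta>. \<eta> y) \<in> borel_measurable P0" "(\<lambda>\<eta>. \<eta> y) \<in> borel_measurable P0" for y
      by (subst measurable_cong_sets[OF sets refl], rule spin_coordinate)+
    show "\<eta> y \<in> {-1, 1}" "\<eta> y \<in> {-1, 1}" if "\<eta> \<in> space P0" for \<eta> y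
      using that by (auto simp: sets_eq_imp_space_eq[OF sets] space_spin_space)
  qed (simp_all add: corr ising_gibbs_mean[OF \<open>ising_gibbs_measure K P0\<close>])
qed

end
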